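(* Let $\Lambda$ be a locally finite connected simple undirected graph, let $\Gamma\leq \mathrm{Aut}(\Lambda)$ act cocompactly on $\Lambda$, and let $H\in \mathbf{Sub}(\mathrm{Aut}(\Lambda))_{\geq\Gamma}$. Fix a vertex $v_0\in V(\Lambda)$. Then for each integer $k\geq 0$, the set $$V_k:=\{J\in \mathbf{Sub}(\mathrm{Aut}(\Lambda))_{\geq\Gamma} \mid \sigma J\sigma^{-1}\leq \overline{H}^{k} \text{ for some } \sigma\in \mathrm{Aut}(\Lambda)_{v_0}^{[k]}\}$$ is a neighborhood of $H$ in $\mathbf{Sub}(\mathrm{Aut}(\Lambda))_{\geq\Gamma}$.
   Context: $\mathrm{Aut}(\Lambda)$ carries the topology of pointwise convergence on vertices; it is a second countable totally disconnected locally compact group. $\mathbf{Sub}(\mathrm{Aut}(\Lambda))$ is the space of closed subgroups with the Chabauty topology: a base of neighborhoods of $H$ is given by the sets $\{J \mid J\cap K\subseteq HU,\ H\cap K\subseteq JU\}$ with $K$ compact and $U$ an open identity neighborhood. A group acts cocompactly on $\Lambda$ if it has finitely many orbits of vertices. For $\Gamma\leq\mathrm{Aut}(\Lambda)$, $\mathbf{Sub}(\mathrm{Aut}(\Lambda))_{\geq\Gamma}:=\{H\in\mathbf{Sub}(\mathrm{Aut}(\Lambda)) \mid H\geq\tau\Gamma\tau^{-1}\text{ for some }\tau\in\mathrm{Aut}(\Lambda)\}$, with the subspace topology. $B(v,k)$ is the ball of radius $k$ around $v$ in $\Lambda$. For $J\leq\mathrm{Aut}(\Lambda)$, the $k$-closure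 of $J$ is $\overline{J}^{k}:=\{g\in\mathrm{Aut}(\Lambda) \mid \forall v\in V(\Lambda),\ \exists h\in J:\ g|_{B(v,k)}=h|_{B(v,k)}\}$. For $J\leq\mathrm{Aut}(\Lambda)$, $v\in V(\Lambda)$ and $r\geq 0$, $J_v^{[r]}$ denotes the pointwise stabilizer of $B(v,r)$ in $J$. *)

theory Defs
  imports "HOL-Analysis.Analysis" "HOL-Algebra.Group_Action"
begin

section \<open>Graphs\<close>

text \<open>
  A graph is given by its vertex set \<open>V\<close> and its adjacency relation \<open>E\<close>; an undirected edge
  between \<open>u\<close> and \<open>v\<close> is represented by both \<open>(u, v) \<in> E\<close> and \<open>(v, u) \<in> E\<close>.
\<close>

definition simple_graph :: "'v set \<Rightarrow> 'v rel \<Rightarrow> bool" where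
  "simple_graph V E \<longleftrightarrow> E \<subseteq> V \<times> V \<and> sym E \<and> irrefl E"

definition graph_connected :: "'v set \<Rightarrow> 'v rel \<Rightarrow> bool" where
  "graph_connected V E \<longleftrightarrow> (\<forall>u\<in>V. \<forall>v\<in>V. (u, v) \<in> E\<^sup>*)"

definition graph_locally_finite :: "'v set \<Rightarrow> 'v rel \<Rightarrow> bool" where
  "graph_locally_finite V E \<longleftrightarrow> (\<forall>v\<in>V. finite (E `` {v}))"

text \<open>The vertices joined to \<open>v\<close> by a walk of length at most \<open>k\<close>.\<close>

definition graph_ball :: "'v rel \<Rightarrow> 'v \<Rightarrow> nat \<Rightarrow> 'v set" where
  "graph_ball E v k = {w. \<exists>n\<le>k. (v, w) \<in> E ^^ n}"


section \<open>The automorphism group\<close>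

definition graph_automorphisms :: "'v set \<Rightarrow> 'v rel \<Rightarrow> ('v \<Rightarrow> 'v) set" where
  "graph_automorphisms V E =
    {g \<in> Bij V. \<forall>u\<in>V. \<forall>v\<in>V. (g u, g v) \<in> E \<longleftrightarrow> (u, v) \<in> E}"

definition Aut :: "'v set \<Rightarrow> 'v rel \<Rightarrow> ('v \<Rightarrow> 'v) monoid" where
  "Aut V E = BijGroup V \<lparr>carrier := graph_automorphisms V E\<rparr>"

text \<open>
  Pointwise convergence on vertices. The elements of \<open>Bij V\<close> are extensional, so they are
  points of the product space \<open>V \<rightarrow>\<^sub>E V\<close>.
\<close>

definition Aut_topology :: "'v set \<Rightarrow> 'v rel \<Rightarrow> ('v \<Rightarrow> 'v) topology" where
  "Aut_topology V E =
    subtopology (product_topology (\<lambda>_. discrete_topology V) V) (carrier (Aut V E))"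

text \<open>
  \<open>\<Gamma>\<close> acts with finitely many orbits of vertices; an automorphism acts on vertices by
  evaluation.
\<close>

definition acts_cocompactly :: "'v set \<Rightarrow> 'v rel \<Rightarrow> ('v \<Rightarrow> 'v) set \<Rightarrow> bool" where
  "acts_cocompactly V E \<Gamma> \<longleftrightarrow>
    finite (orbits (Aut V E \<lparr>carrier := \<Gamma>\<rparr>) V (\<lambda>g. g))"

definition k_closure ::
    "'v set \<Rightarrow> 'v rel \<Rightarrow> nat \<Rightarrow> ('v \<Rightarrow> 'v) set \<Rightarrow> ('v \<Rightarrow> 'v) set" where
  "k_closure V E k J =
    {g \<in> carrier (Aut V E). \<forall>v\<in>V. \<exists>h\<in>J. \<forall>w\<in>graph_ball E v k. g w = h w}"

text \<open>The pointwise stabilizer in \<open>J\<close> of the ball of radius \<open>r\<close> around \<open>v\<close>.\<close>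

definition ball_fixator ::
    "'v rel \<Rightarrow> ('v \<Rightarrow> 'v) set \<Rightarrow> 'v \<Rightarrow> nat \<Rightarrow> ('v \<Rightarrow> 'v) set" where
  "ball_fixator E J v r = {g \<in> J. \<forall>w\<in>graph_ball E v r. g w = w}"


section \<open>The Chabauty space of closed subgroups\<close>

context
  fixes G :: "('a, 'b) monoid_scheme" (structure) and T :: "'a topology"
begin

definition closed_subgroups :: "'a set set" where
  "closed_subgroups = {H. subgroup H G \<and> closedin T H}"

definition chabauty_nbhd :: "'a set \<Rightarrow> 'a set \<Rightarrow> 'a set \<Rightarrow> 'a set set" where
  "chabauty_nbhd H K U =
    {J \<in> closed_subgroups. J \<inter> K \<subseteq> H <#> U \<and> H \<inter> K \<subseteq> J <#> U}"

text \<open>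
  The topology in which, for a topological group, the sets \<open>chabauty_nbhd H K U\<close> with \<open>K\<close>
  compact and \<open>U\<close> an open identity neighborhood form a neighborhood base of \<open>H\<close>: a set is open
  iff it contains such a set around each of its points.
\<close>

definition chabauty_open :: "'a set set \<Rightarrow> bool" where
  "chabauty_open W \<longleftrightarrow> W \<subseteq> closed_subgroups \<and>
    (\<forall>H\<in>W. \<exists>K U. compactin T K \<and> openin T U \<and> \<one> \<in> U \<and> chabauty_nbhd H K U \<subseteq> W)"

definition chabauty_topology :: "'a set topology" where
  "chabauty_topology = topology chabauty_open"

lemma istopology_chabauty_open: "istopology chabauty_open"
  unfolding istopology_def
proof (intro conjI allI impI)
  fix A B assume A: "chabauty_open A" and B: "chabauty_open B"
  show "chabauty_open (A \<inter> B)"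
    unfolding chabauty_open_def
  proof (intro conjI ballI)
    show "A \<inter> B \<subseteq> closed_subgroups"
      using A by (auto simp: chabauty_open_def)
    fix H assume H: "H \<in> A \<inter> B"
    obtain K U where KU: "compactin T K" "openin T U" "\<one> \<in> U" "chabauty_nbhd H K U \<subseteq> A"
      using A H unfolding chabauty_open_def by blast
    obtain L W where LW: "compactin T L" "openin T W" "\<one> \<in> W" "chabauty_nbhd H L W \<subseteq> B"
      using B H unfolding chabauty_open_def by blast
    have "chabauty_nbhd H (K \<union> L) (U \<inter> W) \<subseteq> chabauty_nbhd H K U \<inter> chabauty_nbhd H L W"
      unfolding chabauty_nbhd_def set_mult_def by blast
    then show "\<exists>K U. compactin T K \<and> openin T U \<and> \<one> \<in> U \<and> chabauty_nbhd H K U \<subseteq> A \<inter> B"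
      using KU LW
      by (intro exI[of _ "K \<union> L"] exI[of _ "U \<inter> W"]) (auto intro: compactin_Un)
  qed
next
  fix \<W> assume "\<forall>W\<in>\<W>. chabauty_open W"
  then show "chabauty_open (\<Union>\<W>)"
    unfolding chabauty_open_def by (meson Sup_least Union_iff Union_upper subset_trans)
qed

lemma openin_chabauty_topology: "openin chabauty_topology W \<longleftrightarrow> chabauty_open W"
  unfolding chabauty_topology_def using istopology_chabauty_open by simp

lemma topspace_chabauty_topology:
  assumes "\<one> \<in> topspace T"
  shows "topspace chabauty_topology = closed_subgroups"
proof
  show "topspace chabauty_topology \<subseteq> closed_subgroups"
    using openin_chabauty_topology[of "topspace chabauty_topology"]
    by (auto simp: chabauty_open_def)
  have "chabauty_open closed_subgroups"
    unfolding chabauty_open_def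
  proof (intro conjI ballI)
    fix H :: "'a set"
    have "compactin T {} \<and> openin T (topspace T) \<and> \<one> \<in> topspace T \<and>
        chabauty_nbhd H {} (topspace T) \<subseteq> closed_subgroups"
      using assms by (auto simp: chabauty_nbhd_def)
    then show "\<exists>K U. compactin T K \<and> openin T U \<and> \<one> \<in> U \<and> chabauty_nbhd H K U \<subseteq> closed_subgroups"
      by blast
  qed simp
  then show "closed_subgroups \<subseteq> topspace chabauty_topology"
    by (simp add: openin_chabauty_topology openin_subset)
qed

text \<open>The closed subgroups containing a conjugate of \<open>\<Gamma>\<close>; \<open>\<Gamma>\<close> itself need not be closed.\<close>

definition closed_subgroups_above :: "'a set \<Rightarrow> 'a set set" where
  "closed_subgroups_above \<Gamma> =
    {H \<in> closed_subgroups. \<exists>\<tau>\<in>carrier G. \<tau> <# \<Gamma> #> inv \<tau> \<subseteq> H}"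

end

definition neighborhood_in :: "'a topology \<Rightarrow> 'a \<Rightarrow> 'a set \<Rightarrow> bool" where
  "neighborhood_in X x N \<longleftrightarrow> N \<subseteq> topspace X \<and> (\<exists>W. openin X W \<and> x \<in> W \<and> W \<subseteq> N)"

end

theory Submission
  imports Defs
begin

text \<open>
  Suppose \<open>J\<close> is close to \<open>H\<close> and contains \<open>\<tau>' \<Gamma> \<tau>'\<inverse>\<close>. Since \<open>\<Gamma>\<close> is cocompact,
  \<open>\<tau>'\<close> can be multiplied on the right by an element of \<open>\<Gamma>\<close> so that it lies in a fixed compact
  set; by compactness it suffices to treat \<open>\<tau>'\<close> close to a given \<open>\<tau>\<close>. If \<open>\<tau> \<Gamma> \<tau>\<inverse>\<close> is not
  contained in \<open>H\<close>, then, \<open>H\<close> being closed, no such \<open>J\<close> is close to \<open>H\<close>. Otherwise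
  \<open>\<sigma> = \<tau> \<tau>'\<inverse>\<close> fixes a large ball, and \<open>\<sigma> J \<sigma>\<inverse>\<close> and \<open>H\<close> share the cocompact subgroup
  \<open>\<tau> \<Gamma> \<tau>\<inverse>\<close>. Translating by it moves any \<open>v\<close> and \<open>g v\<close>, for \<open>g \<in> \<sigma> J \<sigma>\<inverse>\<close>, into a
  fixed ball, where closeness of \<open>J\<close> to \<open>H\<close> provides an element of \<open>H\<close> agreeing with \<open>g\<close>
  on the \<open>k\<close>-ball.
\<close>

section \<open>Balls in graphs\<close>

lemma graph_ball_0 [simp]: "graph_ball E v 0 = {v}"
  by (auto simp: graph_ball_def)

lemma graph_ball_center [simp]: "v \<in> graph_ball E v n"
  by (auto simp: graph_ball_def intro: exI[of _ 0])

lemma graph_ball_mono: "m \<le> n \<Longrightarrow> graph_ball E v m \<subseteq> graph_ball E v n"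
  unfolding graph_ball_def using le_trans by blast

lemma graph_ball_trans:
  assumes "w \<in> graph_ball E v m" and "x \<in> graph_ball E w n"
  shows "x \<in> graph_ball E v (m + n)"
proof -
  obtain i j where "i \<le> m" "(v, w) \<in> E ^^ i" "j \<le> n" "(w, x) \<in> E ^^ j"
    using assms by (auto simp: graph_ball_def)
  then have "i + j \<le> m + n" "(v, x) \<in> E ^^ (i + j)"
    by (auto simp: relpow_add)
  then show ?thesis
    by (auto simp: graph_ball_def)
qed

lemma graph_ball_Suc: "graph_ball E v (Suc n) = insert v (\<Union>w\<in>graph_ball E v n. E `` {w})"
proof
  show "graph_ball E v (Suc n) \<subseteq> insert v (\<Union>w\<in>graph_ball E v n. E `` {w})"
  proof
    fix x assume "x \<in> graph_ball E v (Suc n)"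
    then obtain i where i: "i \<le> Suc n" "(v, x) \<in> E ^^ i"
      by (auto simp: graph_ball_def)
    show "x \<in> insert v (\<Union>w\<in>graph_ball E v n. E `` {w})"
    proof (cases i)
      case 0
      then show ?thesis using i by simp
    next
      case (Suc j)
      then show ?thesis using i by (auto simp: graph_ball_def)
    qed
  qed
next
  show "insert v (\<Union>w\<in>graph_ball E v n. E `` {w}) \<subseteq> graph_ball E v (Suc n)"
  proof -
    have "x \<in> graph_ball E v (Suc n)" if "w \<in> graph_ball E v n" "(w, x) \<in> E" for w x
    proof -
      have "x \<in> graph_ball E w 1"
        using that(2) unfolding graph_ball_def by (auto intro!: exI[of _ 1])
      then show ?thesis
        using graph_ball_trans[OF that(1)] by fastforce
    qed
    then show ?thesis by auto
  qed
qed

lemma graph_ball_sym: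
  assumes "sym E" and "w \<in> graph_ball E v n"
  shows "v \<in> graph_ball E w n"
proof -
  have "(w, v) \<in> E ^^ i" if "(v, w) \<in> E ^^ i" for i
    using that
  proof (induction i arbitrary: w)
    case (Suc i)
    then obtain u where u: "(v, u) \<in> E ^^ i" "(u, w) \<in> E"
      by auto
    then show ?case
      using Suc.IH[OF u(1)] symD[OF \<open>sym E\<close> u(2)] by (meson relpow_Suc_I2)
  qed simp
  then show ?thesis
    using assms(2) by (auto simp: graph_ball_def)
qed


section \<open>The automorphism group\<close>

text \<open>Balls around the root form an exhaustion of \<open>V\<close> by finite sets, so one
  radius can control both the compact sets and the identity neighborhoods used below.\<close>

locale rooted_graph =
  fixes V :: "'v set" and E :: "'v rel" and v\<^sub>0 :: 'v
  assumes simple: "simple_graph V E"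
    and connected: "graph_connected V E"
    and locally_finite: "graph_locally_finite V E"
    and root: "v\<^sub>0 \<in> V"
begin

abbreviation "A \<equiv> Aut V E"

abbreviation "rball \<equiv> graph_ball E v\<^sub>0"

lemma edge_in: "(u, v) \<in> E \<Longrightarrow> u \<in> V \<and> v \<in> V"
  using simple by (auto simp: simple_graph_def)

lemma sym_E: "sym E"
  using simple by (simp add: simple_graph_def)

lemma graph_ball_subset: "v \<in> V \<Longrightarrow> graph_ball E v n \<subseteq> V"
  by (induction n) (auto simp: graph_ball_Suc dest: edge_in)

lemma finite_graph_ball: "v \<in> V \<Longrightarrow> finite (graph_ball E v n)"
proof (induction n)
  case (Suc n)
  then show ?case
    using locally_finite graph_ball_subset[of v n]
    by (auto simp: graph_ball_Suc graph_locally_finite_def)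
qed simp

lemma ball_subset: "w \<in> rball n \<Longrightarrow> w \<in> V"
  using graph_ball_subset root by blast

lemma finite_subset_ball:
  assumes "finite F" and "F \<subseteq> V"
  shows "\<exists>n. F \<subseteq> rball n"
  using assms
proof (induction F)
  case (insert x F)
  then obtain n where n: "F \<subseteq> rball n"
    by auto
  have "(v\<^sub>0, x) \<in> E\<^sup>*"
    using connected root insert.prems by (auto simp: graph_connected_def)
  then obtain m where "x \<in> rball m"
    by (auto simp: graph_ball_def rtrancl_power)
  then have "insert x F \<subseteq> rball (max m n)"
    using n graph_ball_mono[of m "max m n"] graph_ball_mono[of n "max m n"] by fastforce
  then show ?case ..
qed simp

lemma in_some_ball: "x \<in> V \<Longrightarrow> \<exists>n. x \<in> rball n"
  using finite_subset_ball[of "{x}"] by auto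

section \<open>Group operations of \<open>A\<close> evaluated on vertices\<close>

lemma carrier_Aut: "carrier A = graph_automorphisms V E"
  by (simp add: Aut_def)

lemma Aut_Bij: "g \<in> carrier A \<Longrightarrow> g \<in> Bij V"
  by (simp add: carrier_Aut graph_automorphisms_def)

lemma Aut_apply_in: "g \<in> carrier A \<Longrightarrow> x \<in> V \<Longrightarrow> g x \<in> V"
  using Aut_Bij Bij_imp_funcset by blast

lemma Aut_edge_iff: "g \<in> carrier A \<Longrightarrow> u \<in> V \<Longrightarrow> v \<in> V \<Longrightarrow> (g u, g v) \<in> E \<longleftrightarrow> (u, v) \<in> E"
  by (simp add: carrier_Aut graph_automorphisms_def)

lemma subgroup_Aut: "subgroup (graph_automorphisms V E) (BijGroup V)"
proof (rule group.subgroupI[OF group_BijGroup])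
  show "graph_automorphisms V E \<subseteq> carrier (BijGroup V)"
    by (auto simp: graph_automorphisms_def BijGroup_def)
  have "(\<lambda>x\<in>V. x) \<in> graph_automorphisms V E"
    by (simp add: graph_automorphisms_def id_Bij)
  then show "graph_automorphisms V E \<noteq> {}"
    by blast
next
  fix g assume g: "g \<in> graph_automorphisms V E"
  then have B: "g \<in> Bij V" and "g ` V = V"
    by (auto simp: graph_automorphisms_def Bij_def bij_betw_def)
  have "(inv_into V g u, inv_into V g v) \<in> E \<longleftrightarrow> (u, v) \<in> E" if "u \<in> V" "v \<in> V" for u v
  proof -
    have "(g (inv_into V g u), g (inv_into V g v)) \<in> E \<longleftrightarrow>
        (inv_into V g u, inv_into V g v) \<in> E"
      using g that Bij_inv_into_mem[OF B] by (simp add: graph_automorphisms_def)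
    then show ?thesis
      using that \<open>g ` V = V\<close> by (simp add: f_inv_into_f)
  qed
  then show "inv\<^bsub>BijGroup V\<^esub> g \<in> graph_automorphisms V E"
    using B by (simp add: inv_BijGroup graph_automorphisms_def restrict_inv_into_Bij)
next
  fix g h assume "g \<in> graph_automorphisms V E" "h \<in> graph_automorphisms V E"
  then show "g \<otimes>\<^bsub>BijGroup V\<^esub> h \<in> graph_automorphisms V E"
    using Bij_imp_funcset[of h V]
    by (auto simp: graph_automorphisms_def BijGroup_def compose_Bij compose_eq Pi_iff)
qed

sublocale Aut: group A
  unfolding Aut_def by (rule subgroup.subgroup_is_group[OF subgroup_Aut group_BijGroup])

lemma mult_apply:
  "g \<in> carrier A \<Longrightarrow> h \<in> carrier A \<Longrightarrow> x \<in> V \<Longrightarrow> (g \<otimes>\<^bsub>A\<^esub> h) x = g (h x)"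
  using Aut_Bij[of g] Aut_Bij[of h] by (simp add: Aut_def BijGroup_def compose_eq)

lemma one_apply: "x \<in> V \<Longrightarrow> \<one>\<^bsub>A\<^esub> x = x"
  by (simp add: Aut_def BijGroup_def)

lemma inv_apply_left: "g \<in> carrier A \<Longrightarrow> x \<in> V \<Longrightarrow> (inv\<^bsub>A\<^esub> g) (g x) = x"
  using mult_apply[of "inv\<^bsub>A\<^esub> g" g x] by (simp add: one_apply)

lemma inv_apply_right: "g \<in> carrier A \<Longrightarrow> x \<in> V \<Longrightarrow> g ((inv\<^bsub>A\<^esub> g) x) = x"
  using mult_apply[of g "inv\<^bsub>A\<^esub> g" x] by (simp add: one_apply)

lemma inv_apply_eq: "g \<in> carrier A \<Longrightarrow> x \<in> V \<Longrightarrow> g x = y \<Longrightarrow> (inv\<^bsub>A\<^esub> g) y = x"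
  using inv_apply_left by blast

lemma conj_apply:
  assumes "g \<in> carrier A" "h \<in> carrier A" "x \<in> V"
  shows "(g \<otimes>\<^bsub>A\<^esub> h \<otimes>\<^bsub>A\<^esub> inv\<^bsub>A\<^esub> g) x = g (h ((inv\<^bsub>A\<^esub> g) x))"
  using assms by (simp add: mult_apply Aut_apply_in)

text \<open>Once \<open>Aut.m_assoc\<close> has nested products to the right, these rules cancel an
  element against its inverse at the head of a word.\<close>

lemma Aut_cancel:
  assumes "g \<in> carrier A" "h \<in> carrier A"
  shows "inv\<^bsub>A\<^esub> g \<otimes>\<^bsub>A\<^esub> (g \<otimes>\<^bsub>A\<^esub> h) = h" "g \<otimes>\<^bsub>A\<^esub> (inv\<^bsub>A\<^esub> g \<otimes>\<^bsub>A\<^esub> h) = h"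
  using assms by (simp_all flip: Aut.m_assoc)

lemma Aut_graph_ball:
  assumes "g \<in> carrier A" "v \<in> V" "w \<in> graph_ball E v n"
  shows "g w \<in> graph_ball E (g v) n"
  using assms(3)
proof (induction n arbitrary: w)
  case (Suc n)
  show ?case
  proof (cases "w = v")
    case False
    then obtain u where u: "u \<in> graph_ball E v n" "(u, w) \<in> E"
      using Suc.prems by (auto simp: graph_ball_Suc)
    then have "(g u, g w) \<in> E"
      using Aut_edge_iff[OF assms(1)] edge_in by blast
    then show ?thesis
      using Suc.IH[OF u(1)] by (auto simp: graph_ball_Suc)
  qed simp
qed simp

text \<open>Applying \<open>inv g\<close> carries the pair \<open>v\<^sub>0\<close>,
  \<open>g v\<^sub>0\<close> to \<open>inv g v\<^sub>0\<close>, \<open>v\<^sub>0\<close> without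
  increasing distance; symmetry of balls does the rest.\<close>

lemma root_displacement_inv:
  assumes "g \<in> carrier A" "g v\<^sub>0 \<in> rball n"
  shows "(inv\<^bsub>A\<^esub> g) v\<^sub>0 \<in> rball n"
proof -
  have "(inv\<^bsub>A\<^esub> g) (g v\<^sub>0) \<in> graph_ball E ((inv\<^bsub>A\<^esub> g) v\<^sub>0) n"
    using Aut_graph_ball[of "inv\<^bsub>A\<^esub> g" v\<^sub>0 "g v\<^sub>0" n] assms root by simp
  then show ?thesis
    using assms root by (auto simp: inv_apply_left intro: graph_ball_sym[OF sym_E])
qed

lemma mem_conj_iff:
  fixes G (structure)
  shows "y \<in> a <# S #> b \<longleftrightarrow> (\<exists>x\<in>S. y = a \<otimes> x \<otimes> b)"
  by (auto simp: l_coset_def r_coset_def)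


section \<open>Topology of pointwise convergence\<close>

abbreviation "\<T> \<equiv> Aut_topology V E"

abbreviation "PT \<equiv> product_topology (\<lambda>_. discrete_topology V) V"

text \<open>The set is a box in the product: the singleton \<open>{f x}\<close> at the finitely many
  coordinates in \<open>F\<close>, all of \<open>V\<close> elsewhere. Such a singleton is open
  because \<open>f x\<close> lies in \<open>V\<close>.\<close>

lemma openin_product_agree:
  assumes "finite F" "F \<subseteq> V" "f ` F \<subseteq> V"
  shows "openin PT {g \<in> V \<rightarrow>\<^sub>E V. \<forall>x\<in>F. g x = f x}"
proof -
  have fV: "f x \<in> V" if "x \<in> F" for x
    using that assms(3) by blast
  have eq: "{g \<in> V \<rightarrow>\<^sub>E V. \<forall>x\<in>F. g x = f x} = (\<Pi>\<^sub>E x\<in>V. if x \<in> F then {f x} else V)"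
    (is "?L = ?R")
  proof
    show "?L \<subseteq> ?R"
    proof
      fix g assume "g \<in> ?L"
      then have g: "g \<in> V \<rightarrow>\<^sub>E V" "\<And>x. x \<in> F \<Longrightarrow> g x = f x"
        by blast+
      have "g x \<in> (if x \<in> F then {f x} else V)" if "x \<in> V" for x
        using g(2)[of x] PiE_mem[OF g(1) that] by simp
      then show "g \<in> ?R"
        using PiE_arb[OF g(1)] by (rule PiE_I)
    qed
    show "?R \<subseteq> ?L"
    proof
      fix g assume g: "g \<in> ?R"
      then have *: "g x \<in> (if x \<in> F then {f x} else V)" if "x \<in> V" for x
        using that by (rule PiE_mem)
      have "g x \<in> V" if "x \<in> V" for x
        using *[OF that] fV by (cases "x \<in> F") auto
      moreover have "g x = f x" if "x \<in> F" for x
        using *[of x] that assms(2) by auto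
      ultimately show "g \<in> ?L"
        using g by (simp add: PiE_iff)
    qed
  qed
  have "finite {x \<in> V. (if x \<in> F then {f x} else V) \<noteq> V}"
    by (rule finite_subset[OF _ assms(1)]) auto
  then show ?thesis
    unfolding eq using fV by (simp add: openin_PiE_gen)
qed

lemma Aut_subset_PiE: "carrier A \<subseteq> V \<rightarrow>\<^sub>E V"
  using Aut_Bij by (auto simp: Bij_def bij_betw_def PiE_def)

lemma topspace_Aut: "topspace \<T> = carrier A"
  using Aut_subset_PiE by (auto simp: Aut_topology_def)

lemma openin_agree:
  assumes "finite F" "F \<subseteq> V" "f ` F \<subseteq> V"
  shows "openin \<T> {g \<in> carrier A. \<forall>x\<in>F. g x = f x}"
proof -
  have "{g \<in> carrier A. \<forall>x\<in>F. g x = f x} = carrier A \<inter> {g \<in> V \<rightarrow>\<^sub>E V. \<forall>x\<in>F. g x = f x}"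
    using Aut_subset_PiE by blast
  then show ?thesis
    using openin_subtopology_Int2[OF openin_product_agree[OF assms]] by (simp only: Aut_topology_def)
qed

text \<open>A basic open box around \<open>f\<close> restricts only finitely many coordinates; these
  form \<open>F\<close>.\<close>

lemma openin_contains_agree:
  assumes "openin \<T> S" "f \<in> S"
  obtains F where "finite F" "F \<subseteq> V" "\<And>g. g \<in> carrier A \<Longrightarrow> \<forall>x\<in>F. g x = f x \<Longrightarrow> g \<in> S"
proof -
  obtain P where P: "openin PT P" "S = P \<inter> carrier A"
    using assms(1) unfolding Aut_topology_def openin_subtopology by blast
  with assms(2) have "f \<in> P"
    by blast
  then obtain U where "finite {i \<in> V. U i \<noteq> topspace (discrete_topology V)}"
    and U: "f \<in> Pi\<^sub>E V U" "Pi\<^sub>E V U \<subseteq> P"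
    using P(1) unfolding openin_product_topology_alt by meson
  then have fin: "finite {i \<in> V. U i \<noteq> V}"
    by simp
  have "g \<in> S" if g: "g \<in> carrier A" and eq: "\<forall>x\<in>{i \<in> V. U i \<noteq> V}. g x = f x" for g
  proof -
    have "g x \<in> U x" if "x \<in> V" for x
      using that eq PiE_mem[OF U(1) that] Aut_apply_in[OF g that] by (cases "U x = V") auto
    then have "g \<in> Pi\<^sub>E V U"
      using g Aut_subset_PiE by (auto simp: PiE_def)
    then show ?thesis
      using U P g by blast
  qed
  with fin show ?thesis
    by (intro that[of "{i \<in> V. U i \<noteq> V}"]) auto
qed

section \<open>Compact sets and identity neighborhoods indexed by a radius\<close>

text \<open>\<open>moving n\<close> supplies the compact sets and \<open>fixing n\<close> the open
  identity neighborhoods for the Chabauty topology, both measured by a radius around the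
  root.\<close>

definition moving :: "nat \<Rightarrow> ('v \<Rightarrow> 'v) set" where
  "moving n = {g \<in> carrier A. g v\<^sub>0 \<in> rball n}"

definition fixing :: "nat \<Rightarrow> ('v \<Rightarrow> 'v) set" where
  "fixing n = ball_fixator E (carrier A) v\<^sub>0 n"

lemma openin_fixing: "openin \<T> (fixing n)"
  unfolding fixing_def ball_fixator_def
  using openin_agree[of "rball n" id] finite_graph_ball[OF root] graph_ball_subset[OF root] by simp

text \<open>
  A pointwise limit of automorphisms need not be surjective; it is here, because the
  preimages of a vertex under elements of \<open>moving n\<close> all lie in one finite ball.
\<close>

lemma closedin_moving: "closedin PT (moving n)"
proof -
  have "PT closure_of moving n \<subseteq> moving n"
  proof
    fix f assume f: "f \<in> PT closure_of moving n"
    then have f_PiE: "f \<in> V \<rightarrow>\<^sub>E V"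
      by (auto simp: in_closure_of)
    \<comment> \<open>A point of the closure meets each of its agreement neighborhoods, so on every
      finite set of vertices it coincides with some member of \<open>moving n\<close>. The
      properties below involve finitely many values at a time and are inherited from such a
      member.\<close>
    have agree: "\<exists>g\<in>moving n. \<forall>x\<in>F. g x = f x" if "finite F" "F \<subseteq> V" for F
    proof -
      have "openin PT {g \<in> V \<rightarrow>\<^sub>E V. \<forall>x\<in>F. g x = f x}"
        using that f_PiE by (intro openin_product_agree) auto
      moreover have "f \<in> {g \<in> V \<rightarrow>\<^sub>E V. \<forall>x\<in>F. g x = f x}"
        using f_PiE by blast
      ultimately obtain g where "g \<in> moving n" "g \<in> {g \<in> V \<rightarrow>\<^sub>E V. \<forall>x\<in>F. g x = f x}"
        using f unfolding in_closure_of by meson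
      then show ?thesis
        by blast
    qed
    have inj: "inj_on f V"
    proof (rule inj_onI)
      fix x y assume xy: "x \<in> V" "y \<in> V" "f x = f y"
      obtain g where "g \<in> moving n" "g x = f x" "g y = f y"
        using agree[of "{x, y}"] xy by auto
      then have "g \<in> carrier A" "g x = g y"
        using xy(3) by (auto simp: moving_def)
      then show "x = y"
        using xy inv_apply_left by metis
    qed
    have edges: "(f x, f y) \<in> E \<longleftrightarrow> (x, y) \<in> E" if xy: "x \<in> V" "y \<in> V" for x y
    proof -
      obtain g where "g \<in> moving n" "g x = f x" "g y = f y"
        using agree[of "{x, y}"] xy by auto
      then show ?thesis
        using Aut_edge_iff[of g x y] xy by (auto simp: moving_def)
    qed
    have surj: "w \<in> f ` V" if w: "w \<in> V" for w
    proof -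
      obtain m where m: "w \<in> rball m"
        using in_some_ball[OF w] by blast
      \<comment> \<open>Radius \<open>n + m\<close> suffices: \<open>inv g\<close> moves the root by
        at most \<open>n\<close>, and \<open>w\<close> is within \<open>m\<close> of the root, so
        \<open>f\<close> and \<open>g\<close> agree at \<open>inv g w\<close>.\<close>
      obtain g where "g \<in> moving n" and eq: "\<forall>x\<in>rball (n + m). g x = f x"
        using agree[of "rball (n + m)"] finite_graph_ball[OF root] graph_ball_subset[OF root]
        by blast
      then have g: "g \<in> carrier A" "g v\<^sub>0 \<in> rball n"
        by (auto simp: moving_def)
      have "(inv\<^bsub>A\<^esub> g) w \<in> graph_ball E ((inv\<^bsub>A\<^esub> g) v\<^sub>0) m"
        using Aut_graph_ball[of "inv\<^bsub>A\<^esub> g" v\<^sub>0 w m] g m root by simp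
      then have "(inv\<^bsub>A\<^esub> g) w \<in> rball (n + m)"
        by (rule graph_ball_trans[OF root_displacement_inv[OF g]])
      then have "f ((inv\<^bsub>A\<^esub> g) w) = w"
        using eq g w by (metis inv_apply_right)
      then show ?thesis
        using g w Aut.inv_closed Aut_apply_in by (metis image_eqI)
    qed
    have "f \<in> carrier A"
      using f_PiE inj surj edges
      by (auto simp: carrier_Aut graph_automorphisms_def Bij_def bij_betw_def PiE_def)
    moreover have "f v\<^sub>0 \<in> rball n"
      using agree[of "{v\<^sub>0}"] root by (auto simp: moving_def)
    ultimately show "f \<in> moving n"
      by (simp add: moving_def)
  qed
  moreover have "moving n \<subseteq> topspace PT"
    using Aut_subset_PiE by (auto simp: moving_def)
  ultimately show ?thesis
    using closure_of_subset_eq by metis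
qed

text \<open>If \<open>v\<close> is within \<open>d v\<close> of the root, a member of
  \<open>moving n\<close> sends it to within \<open>n + d v\<close>. Thus \<open>moving n\<close> is
  a closed subset of a product of finite balls, which is compact by Tychonoff.\<close>

lemma compactin_moving: "compactin \<T> (moving n)"
proof -
  have "\<exists>d. \<forall>v\<in>V. v \<in> rball (d v)"
    using in_some_ball by metis
  then obtain d where d: "\<And>v. v \<in> V \<Longrightarrow> v \<in> rball (d v)"
    by blast
  have "g v \<in> rball (n + d v)" if "g \<in> moving n" "v \<in> V" for g v
    using that d Aut_graph_ball[OF _ root, of g v "d v"]
    by (auto simp: moving_def intro: graph_ball_trans[of "g v\<^sub>0"])
  then have "moving n \<subseteq> (\<Pi>\<^sub>E v\<in>V. rball (n + d v))"
    using Aut_subset_PiE by (auto simp: moving_def PiE_def)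
  moreover have "compactin PT (\<Pi>\<^sub>E v\<in>V. rball (n + d v))"
    using finite_graph_ball[OF root] graph_ball_subset[OF root]
    by (auto simp: compactin_PiE finite_imp_compactin)
  ultimately have "compactin PT (moving n)"
    using closed_compactin closedin_moving by blast
  then show ?thesis
    unfolding Aut_topology_def by (auto simp: compactin_subtopology moving_def)
qed


section \<open>Chabauty neighborhoods\<close>

abbreviation "Sub \<equiv> closed_subgroups A \<T>"

abbreviation "nbhd H n \<equiv> chabauty_nbhd A \<T> H (moving n) (fixing n)"

lemma Sub_subgroup: "H \<in> Sub \<Longrightarrow> subgroup H A"
  by (simp add: closed_subgroups_def)

lemma Sub_carrier: "H \<in> Sub \<Longrightarrow> h \<in> H \<Longrightarrow> h \<in> carrier A"
  by (rule subgroup.mem_carrier[OF Sub_subgroup])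

text \<open>\<open>g\<close> lies in the coset of \<open>fixing n\<close> through \<open>h\<close>
  exactly when \<open>inv h \<otimes> g\<close> fixes the ball pointwise, that is, when
  \<open>g\<close> and \<open>h\<close> agree on it.\<close>

lemma mem_set_mult_fixing:
  assumes "S \<subseteq> carrier A" "g \<in> carrier A"
  shows "g \<in> S <#>\<^bsub>A\<^esub> fixing n \<longleftrightarrow> (\<exists>h\<in>S. \<forall>x\<in>rball n. g x = h x)"
proof
  assume "g \<in> S <#>\<^bsub>A\<^esub> fixing n"
  then obtain h u where "h \<in> S" "u \<in> fixing n" "g = h \<otimes>\<^bsub>A\<^esub> u"
    by (auto simp: set_mult_def)
  then show "\<exists>h\<in>S. \<forall>x\<in>rball n. g x = h x"
    using assms ball_subset mult_apply[of h u]
    by (auto simp: fixing_def ball_fixator_def subset_iff intro!: bexI[of _ h])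
next
  assume "\<exists>h\<in>S. \<forall>x\<in>rball n. g x = h x"
  then obtain h where h: "h \<in> S" "\<And>x. x \<in> rball n \<Longrightarrow> g x = h x"
    by blast
  then have hc: "h \<in> carrier A"
    using assms by blast
  have "(inv\<^bsub>A\<^esub> h \<otimes>\<^bsub>A\<^esub> g) x = x" if "x \<in> rball n" for x
    using that h hc assms ball_subset[OF that] by (simp add: mult_apply inv_apply_left)
  then have "inv\<^bsub>A\<^esub> h \<otimes>\<^bsub>A\<^esub> g \<in> fixing n"
    using hc assms by (simp add: fixing_def ball_fixator_def)
  moreover have "g = h \<otimes>\<^bsub>A\<^esub> (inv\<^bsub>A\<^esub> h \<otimes>\<^bsub>A\<^esub> g)"
    using hc assms by (simp add: Aut_cancel)
  ultimately show "g \<in> S <#>\<^bsub>A\<^esub> fixing n"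
    using h(1) by (auto simp: set_mult_def)
qed

lemma Int_moving_subset_iff:
  assumes "S \<subseteq> carrier A" "S' \<subseteq> carrier A"
  shows "S \<inter> moving n \<subseteq> S' <#>\<^bsub>A\<^esub> fixing n \<longleftrightarrow>
    (\<forall>g\<in>S. g v\<^sub>0 \<in> rball n \<longrightarrow> (\<exists>h\<in>S'. \<forall>x\<in>rball n. g x = h x))"
  using assms mem_set_mult_fixing[OF assms(2)] by (auto simp: moving_def subset_iff)

text \<open>Closeness turns into a condition on values in one finite ball, symmetric in
  \<open>H\<close> and \<open>J\<close>; later arguments use only this form.\<close>

lemma mem_nbhd_iff:
  assumes "H \<in> Sub"
  shows "J \<in> nbhd H n \<longleftrightarrow> J \<in> Sub \<and>
    (\<forall>g\<in>J. g v\<^sub>0 \<in> rball n \<longrightarrow> (\<exists>h\<in>H. \<forall>x\<in>rball n. g x = h x)) \<and>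
    (\<forall>g\<in>H. g v\<^sub>0 \<in> rball n \<longrightarrow> (\<exists>h\<in>J. \<forall>x\<in>rball n. g x = h x))"
proof (cases "J \<in> Sub")
  case True
  have "H \<subseteq> carrier A" "J \<subseteq> carrier A"
    using Sub_carrier[OF assms] Sub_carrier[OF True] by auto
  then show ?thesis
    using True by (simp add: chabauty_nbhd_def Int_moving_subset_iff)
qed (simp add: chabauty_nbhd_def)

lemma nbhd_refl: "H \<in> Sub \<Longrightarrow> H \<in> nbhd H n"
  by (auto simp: mem_nbhd_iff)

text \<open>The ball contains the root, so an approximating element moves the root to the same
  vertex and can itself be approximated. Hence no radius is lost.\<close>

lemma nbhd_trans:
  assumes "H \<in> Sub" "J \<in> nbhd H n" "I \<in> nbhd J n"
  shows "I \<in> nbhd H n"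
proof -
  have trans: "\<exists>h\<in>S''. \<forall>x\<in>rball n. g x = h x"
    if "\<forall>g\<in>S. g v\<^sub>0 \<in> rball n \<longrightarrow> (\<exists>h\<in>S'. \<forall>x\<in>rball n. g x = h x)"
      and "\<forall>g\<in>S'. g v\<^sub>0 \<in> rball n \<longrightarrow> (\<exists>h\<in>S''. \<forall>x\<in>rball n. g x = h x)"
      and "g \<in> S" "g v\<^sub>0 \<in> rball n"
    for S S' S'' :: "('v \<Rightarrow> 'v) set" and g
    using that by (metis graph_ball_center)
  have "J \<in> Sub"
    using assms by (simp add: mem_nbhd_iff)
  with assms show ?thesis
    unfolding mem_nbhd_iff[OF assms(1)] mem_nbhd_iff[OF \<open>J \<in> Sub\<close>]
    by (auto intro: trans[of I J H] trans[of H J I])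
qed

text \<open>
  Being in \<open>nbhd H n\<close> is an equivalence relation between \<open>H\<close> and \<open>J\<close>, so these particular
  neighborhoods are open.
\<close>

lemma openin_nbhd:
  assumes "H \<in> Sub"
  shows "openin (chabauty_topology A \<T>) (nbhd H n)"
  unfolding openin_chabauty_topology chabauty_open_def
proof (intro conjI ballI)
  show "nbhd H n \<subseteq> Sub"
    by (auto simp: chabauty_nbhd_def)
  fix J assume "J \<in> nbhd H n"
  then have "nbhd J n \<subseteq> nbhd H n"
    using nbhd_trans[OF assms] by blast
  moreover have "\<one>\<^bsub>A\<^esub> \<in> fixing n"
    by (auto simp: fixing_def ball_fixator_def one_apply dest: ball_subset)
  ultimately show "\<exists>K U. compactin \<T> K \<and> openin \<T> U \<and> \<one>\<^bsub>A\<^esub> \<in> U \<and>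
      chabauty_nbhd A \<T> J K U \<subseteq> nbhd H n"
    using compactin_moving openin_fixing by blast
qed

text \<open>As the radius grows, \<open>moving\<close> grows and \<open>fixing\<close> shrinks, and
  both changes strengthen the condition.\<close>

lemma nbhd_antimono:
  assumes "m \<le> n"
  shows "nbhd H n \<subseteq> nbhd H m"
proof -
  have moving: "moving m \<subseteq> moving n"
    using graph_ball_mono[OF assms, of E v\<^sub>0] by (auto simp: moving_def)
  have fixing: "fixing n \<subseteq> fixing m"
    using graph_ball_mono[OF assms, of E v\<^sub>0] by (auto simp: fixing_def ball_fixator_def)
  have mult: "S <#>\<^bsub>A\<^esub> fixing n \<subseteq> S <#>\<^bsub>A\<^esub> fixing m" for S
    unfolding set_mult_def using fixing by (intro UN_mono) auto
  show ?thesis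
    unfolding chabauty_nbhd_def
  proof (intro Collect_mono impI, elim conjE, intro conjI)
    fix J assume J: "J \<inter> moving n \<subseteq> H <#>\<^bsub>A\<^esub> fixing n" "H \<inter> moving n \<subseteq> J <#>\<^bsub>A\<^esub> fixing n"
    show "J \<inter> moving m \<subseteq> H <#>\<^bsub>A\<^esub> fixing m"
      using J(1) moving mult[of H] by fast
    show "H \<inter> moving m \<subseteq> J <#>\<^bsub>A\<^esub> fixing m"
      using J(2) moving mult[of J] by fast
  qed
qed

lemma nbhd_approx:
  assumes "H \<in> Sub" "J \<in> nbhd H n" "g \<in> J" "g v\<^sub>0 \<in> rball n"
  obtains h where "h \<in> H" "\<And>x. x \<in> rball n \<Longrightarrow> g x = h x"
  using assms(2-4) that unfolding mem_nbhd_iff[OF assms(1)] by blast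


section \<open>Conjugates of a cocompact subgroup\<close>

text \<open>The conjugator is kept as a parameter so that it can range over a compact set.\<close>

definition contains_conj :: "('v \<Rightarrow> 'v) set \<Rightarrow> ('v \<Rightarrow> 'v) \<Rightarrow> ('v \<Rightarrow> 'v) set \<Rightarrow> bool" where
  "contains_conj \<Gamma> \<tau> J \<longleftrightarrow> (\<forall>\<gamma>\<in>\<Gamma>. \<tau> \<otimes>\<^bsub>A\<^esub> \<gamma> \<otimes>\<^bsub>A\<^esub> inv\<^bsub>A\<^esub> \<tau> \<in> J)"

text \<open>This is the condition on \<open>J\<close> that cuts out the set \<open>V_k\<close> of
  the theorem.\<close>

definition subconj :: "nat \<Rightarrow> ('v \<Rightarrow> 'v) set \<Rightarrow> ('v \<Rightarrow> 'v) set \<Rightarrow> bool" where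
  "subconj k H J \<longleftrightarrow> (\<exists>\<sigma>\<in>fixing k. \<sigma> <#\<^bsub>A\<^esub> J #>\<^bsub>A\<^esub> inv\<^bsub>A\<^esub> \<sigma> \<subseteq> k_closure V E k H)"

lemma closed_subgroups_above_iff:
  "J \<in> closed_subgroups_above A \<T> \<Gamma> \<longleftrightarrow> J \<in> Sub \<and> (\<exists>\<tau>\<in>carrier A. contains_conj \<Gamma> \<tau> J)"
  by (auto simp: closed_subgroups_above_def contains_conj_def subset_iff mem_conj_iff)

text \<open>Finitely many orbits have finitely many representatives, and these lie in a common ball
  around the root.\<close>

lemma cocompact_imp_ball:
  assumes "subgroup \<Gamma> A" "acts_cocompactly V E \<Gamma>"
  obtains R where "\<And>x. x \<in> V \<Longrightarrow> \<exists>\<gamma>\<in>\<Gamma>. \<exists>y\<in>rball R. x = \<gamma> y"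
proof -
  have orbit: "orbit (A\<lparr>carrier := \<Gamma>\<rparr>) (\<lambda>g. g) x = (\<lambda>g. g x) ` \<Gamma>" for x
    by (auto simp: orbit_def)
  have "finite ((\<lambda>x. (\<lambda>g. g x) ` \<Gamma>) ` V)"
    using assms(2) by (simp add: acts_cocompactly_def orbits_def orbit image_def Bex_def conj_commute)
  then obtain F where F: "finite F" "F \<subseteq> V"
    "(\<lambda>x. (\<lambda>g. g x) ` \<Gamma>) ` V = (\<lambda>x. (\<lambda>g. g x) ` \<Gamma>) ` F"
    by (rule finite_subset_image[OF _ subset_refl, THEN exE]) blast
  obtain R where R: "F \<subseteq> rball R"
    using finite_subset_ball[OF F(1,2)] by blast
  have "\<exists>\<gamma>\<in>\<Gamma>. \<exists>y\<in>rball R. x = \<gamma> y" if x: "x \<in> V" for x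
  proof -
    have "(\<lambda>g. g x) ` \<Gamma> \<in> (\<lambda>x. (\<lambda>g. g x) ` \<Gamma>) ` F"
      unfolding F(3)[symmetric] using x by (rule imageI)
    then obtain y where y: "y \<in> F" "(\<lambda>g. g x) ` \<Gamma> = (\<lambda>g. g y) ` \<Gamma>"
      by (rule imageE)
    have "\<one>\<^bsub>A\<^esub> x \<in> (\<lambda>g. g y) ` \<Gamma>"
      unfolding y(2)[symmetric] by (rule imageI[OF subgroup.one_closed[OF assms(1)]])
    then obtain \<gamma> where "\<gamma> \<in> \<Gamma>" "\<one>\<^bsub>A\<^esub> x = \<gamma> y"
      by (rule imageE)
    then show ?thesis
      using y(1) R x one_apply by force
  qed
  then show ?thesis
    using that by blast
qed

text \<open>Replacing \<tau> by \<open>\<tau> \<otimes> \<gamma>\<close> with \<gamma> in \<Gamma>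
  leaves the conjugate of \<Gamma> unchanged. Taking \<gamma> with
  \<open>inv \<tau> v\<^sub>0 = \<gamma> y\<close> and \<open>y\<close> in \<open>rball R\<close>
  makes the new conjugator send \<open>y\<close> to the root.\<close>

lemma contains_conj_bounded:
  assumes \<Gamma>: "subgroup \<Gamma> A" and \<tau>: "\<tau> \<in> carrier A" "contains_conj \<Gamma> \<tau> J"
    and R: "\<And>x. x \<in> V \<Longrightarrow> \<exists>\<gamma>\<in>\<Gamma>. \<exists>y\<in>rball R. x = \<gamma> y"
  obtains \<tau>' where "\<tau>' \<in> moving R" "contains_conj \<Gamma> \<tau>' J"
proof -
  have "(inv\<^bsub>A\<^esub> \<tau>) v\<^sub>0 \<in> V"
    using \<tau> root by (simp add: Aut_apply_in)
  then obtain \<gamma> y where \<gamma>: "\<gamma> \<in> \<Gamma>" "y \<in> rball R" "(inv\<^bsub>A\<^esub> \<tau>) v\<^sub>0 = \<gamma> y"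
    using R by blast
  have \<gamma>c: "\<gamma> \<in> carrier A"
    using \<gamma> by (auto intro: subgroup.mem_carrier[OF \<Gamma>])
  define \<tau>' where "\<tau>' = \<tau> \<otimes>\<^bsub>A\<^esub> \<gamma>"
  have c: "\<tau>' \<in> carrier A"
    using \<tau> \<gamma>c by (simp add: \<tau>'_def)
  have "\<tau>' y = v\<^sub>0"
    using \<tau> \<gamma> \<gamma>c root ball_subset by (metis \<tau>'_def mult_apply inv_apply_right)
  then have "(inv\<^bsub>A\<^esub> \<tau>') v\<^sub>0 = y"
    using c \<gamma> ball_subset inv_apply_eq by blast
  then have "\<tau>' v\<^sub>0 \<in> rball R"
    using root_displacement_inv[of "inv\<^bsub>A\<^esub> \<tau>'" R] c \<gamma> by simp
  moreover have "contains_conj \<Gamma> \<tau>' J"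
    unfolding contains_conj_def
  proof
    fix \<delta> assume \<delta>: "\<delta> \<in> \<Gamma>"
    then have \<delta>c: "\<delta> \<in> carrier A"
      by (rule subgroup.mem_carrier[OF \<Gamma>])
    have "\<gamma> \<otimes>\<^bsub>A\<^esub> \<delta> \<otimes>\<^bsub>A\<^esub> inv\<^bsub>A\<^esub> \<gamma> \<in> \<Gamma>"
      using \<Gamma> \<gamma> \<delta> by (simp add: subgroup.m_closed subgroup.m_inv_closed)
    then have "\<tau> \<otimes>\<^bsub>A\<^esub> (\<gamma> \<otimes>\<^bsub>A\<^esub> \<delta> \<otimes>\<^bsub>A\<^esub> inv\<^bsub>A\<^esub> \<gamma>) \<otimes>\<^bsub>A\<^esub> inv\<^bsub>A\<^esub> \<tau> \<in> J"
      using \<tau>(2) unfolding contains_conj_def by blast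
    then show "\<tau>' \<otimes>\<^bsub>A\<^esub> \<delta> \<otimes>\<^bsub>A\<^esub> inv\<^bsub>A\<^esub> \<tau>' \<in> J"
      using \<tau>(1) \<gamma>c \<delta>c by (simp add: \<tau>'_def Aut.inv_mult_group Aut.m_assoc)
  qed
  ultimately show ?thesis
    using that c by (auto simp: moving_def)
qed

section \<open>From closeness of \<open>J\<close> to containment in the
  \<open>k\<close>-closure\<close>

lemma subconj_if_contained:
  assumes \<Gamma>: "subgroup \<Gamma> A" and R: "\<And>x. x \<in> V \<Longrightarrow> \<exists>\<gamma>\<in>\<Gamma>. \<exists>y\<in>rball R. x = \<gamma> y"
    and H: "H \<in> Sub" and \<tau>: "\<tau> \<in> carrier A" "contains_conj \<Gamma> \<tau> H"
    and r: "\<tau> ` rball R \<subseteq> rball r"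
    and \<tau>': "\<tau>' \<in> carrier A" "contains_conj \<Gamma> \<tau>' J"
    and agree: "\<And>x. x \<in> rball (r + k) \<Longrightarrow> \<tau>' ((inv\<^bsub>A\<^esub> \<tau>) x) = x"
    and J: "J \<in> nbhd H (2 * r + k)"
  shows "subconj k H J"
proof -
  \<comment> \<open>\<sigma> conjugates \<open>\<tau>' \<Gamma> inv \<tau>'\<close> to
    \<open>\<tau> \<Gamma> inv \<tau>\<close>. By \<open>agree\<close>, the inverses of \<tau> and
    \<open>\<tau>'\<close> coincide on \<open>rball (r + k)\<close>, so \<sigma> is the identity
    there.\<close>
  define \<sigma> where "\<sigma> = \<tau> \<otimes>\<^bsub>A\<^esub> inv\<^bsub>A\<^esub> \<tau>'"
  have JS: "J \<in> Sub"
    using J by (simp add: chabauty_nbhd_def)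
  have \<sigma>: "\<sigma> \<in> carrier A"
    using \<tau> \<tau>' by (simp add: \<sigma>_def)
  have \<sigma>_fix: "\<sigma> x = x" if "x \<in> rball (r + k)" for x
  proof -
    have xV: "x \<in> V"
      using that ball_subset by blast
    then have "(inv\<^bsub>A\<^esub> \<tau>') x = (inv\<^bsub>A\<^esub> \<tau>) x"
      using agree[OF that] \<tau> \<tau>' by (intro inv_apply_eq) (auto simp: Aut_apply_in)
    then show ?thesis
      using xV \<tau> \<tau>' by (simp add: \<sigma>_def mult_apply inv_apply_right)
  qed
  have inv\<sigma>_fix: "(inv\<^bsub>A\<^esub> \<sigma>) x = x" if "x \<in> rball (r + k)" for x
    using inv_apply_eq[OF \<sigma> ball_subset \<sigma>_fix] that by blast
  have "\<sigma> \<in> fixing k"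
    using \<sigma> \<sigma>_fix graph_ball_mono[of k "r + k" E v\<^sub>0]
    by (auto simp: fixing_def ball_fixator_def)
  moreover have "\<sigma> <#\<^bsub>A\<^esub> J #>\<^bsub>A\<^esub> inv\<^bsub>A\<^esub> \<sigma> \<subseteq> k_closure V E k H"
  proof
    fix g assume "g \<in> \<sigma> <#\<^bsub>A\<^esub> J #>\<^bsub>A\<^esub> inv\<^bsub>A\<^esub> \<sigma>"
    then obtain j where j: "j \<in> J" and g: "g = \<sigma> \<otimes>\<^bsub>A\<^esub> j \<otimes>\<^bsub>A\<^esub> inv\<^bsub>A\<^esub> \<sigma>"
      by (auto simp: mem_conj_iff)
    have jc: "j \<in> carrier A" and gc: "g \<in> carrier A"
      using Sub_carrier[OF JS j] \<sigma> g by auto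
    \<comment> \<open>Conjugation by \<tau> transports the covering by \<Gamma>-translates of
      \<open>rball R\<close>; since \<tau> maps that ball into \<open>rball r\<close>, the latter
      meets every orbit of the conjugate.\<close>
    have cover: "\<exists>\<gamma>\<in>\<Gamma>. \<exists>y\<in>rball r. x = (\<tau> \<otimes>\<^bsub>A\<^esub> \<gamma> \<otimes>\<^bsub>A\<^esub> inv\<^bsub>A\<^esub> \<tau>) y" if x: "x \<in> V" for x
    proof -
      obtain \<gamma> y where y: "\<gamma> \<in> \<Gamma>" "y \<in> rball R" "(inv\<^bsub>A\<^esub> \<tau>) x = \<gamma> y"
        using R[of "(inv\<^bsub>A\<^esub> \<tau>) x"] x \<tau> Aut_apply_in by (metis Aut.inv_closed)
      have "\<gamma> \<in> carrier A" "y \<in> V"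
        using y subgroup.mem_carrier[OF \<Gamma>] ball_subset by auto
      then have "(\<tau> \<otimes>\<^bsub>A\<^esub> \<gamma> \<otimes>\<^bsub>A\<^esub> inv\<^bsub>A\<^esub> \<tau>) (\<tau> y) = x"
        using \<tau> x y(3) inv_apply_right[OF \<tau>(1) x]
        by (simp add: conj_apply Aut_apply_in inv_apply_left)
      then show ?thesis
        using y r by (metis image_subset_iff)
    qed
    have "\<exists>h\<in>H. \<forall>w\<in>graph_ball E v k. g w = h w" if v: "v \<in> V" for v
    proof -
      obtain \<gamma> x where \<gamma>: "\<gamma> \<in> \<Gamma>" "x \<in> rball r" "v = (\<tau> \<otimes>\<^bsub>A\<^esub> \<gamma> \<otimes>\<^bsub>A\<^esub> inv\<^bsub>A\<^esub> \<tau>) x"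
        using cover[OF v] by blast
      obtain \<delta> y where \<delta>: "\<delta> \<in> \<Gamma>" "y \<in> rball r" "g v = (\<tau> \<otimes>\<^bsub>A\<^esub> \<delta> \<otimes>\<^bsub>A\<^esub> inv\<^bsub>A\<^esub> \<tau>) y"
        using cover[OF Aut_apply_in[OF gc v]] by blast
      define a where "a = \<tau> \<otimes>\<^bsub>A\<^esub> \<gamma> \<otimes>\<^bsub>A\<^esub> inv\<^bsub>A\<^esub> \<tau>"
      define d where "d = \<tau> \<otimes>\<^bsub>A\<^esub> \<delta> \<otimes>\<^bsub>A\<^esub> inv\<^bsub>A\<^esub> \<tau>"
      define a' where "a' = \<tau>' \<otimes>\<^bsub>A\<^esub> \<gamma> \<otimes>\<^bsub>A\<^esub> inv\<^bsub>A\<^esub> \<tau>'"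
      define d' where "d' = \<tau>' \<otimes>\<^bsub>A\<^esub> \<delta> \<otimes>\<^bsub>A\<^esub> inv\<^bsub>A\<^esub> \<tau>'"
      \<comment> \<open>Conjugating \<open>b\<close> by \<sigma> gives
        \<open>inv d \<otimes> g \<otimes> a\<close>, which sends \<open>x\<close> to
        \<open>y\<close>. Using \<open>a'\<close> and \<open>d'\<close> in place of \<open>a\<close>
        and \<open>d\<close> keeps \<open>b\<close> inside \<open>J\<close>.\<close>
      define b where "b = inv\<^bsub>A\<^esub> d' \<otimes>\<^bsub>A\<^esub> j \<otimes>\<^bsub>A\<^esub> a'"
      have \<gamma>c: "\<gamma> \<in> carrier A" and \<delta>c: "\<delta> \<in> carrier A"
        using \<gamma> \<delta> by (auto intro: subgroup.mem_carrier[OF \<Gamma>])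
      have H_mem: "a \<in> H" "d \<in> H" and J_mem: "a' \<in> J" "d' \<in> J"
        using \<tau> \<tau>' \<gamma> \<delta> by (auto simp: contains_conj_def a_def d_def a'_def d'_def)
      have ac: "a \<in> carrier A" "d \<in> carrier A" "a' \<in> carrier A" "d' \<in> carrier A"
        using H_mem J_mem Sub_carrier[OF H] Sub_carrier[OF JS] by auto
      have bJ: "b \<in> J"
        using J_mem j Sub_subgroup[OF JS] by (simp add: b_def subgroup.m_closed subgroup.m_inv_closed)
      have bc: "b \<in> carrier A"
        by (rule Sub_carrier[OF JS bJ])
      have conj: "\<sigma> \<otimes>\<^bsub>A\<^esub> a' = a \<otimes>\<^bsub>A\<^esub> \<sigma>" "\<sigma> \<otimes>\<^bsub>A\<^esub> d' = d \<otimes>\<^bsub>A\<^esub> \<sigma>"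
        using \<tau> \<tau>' \<gamma>c \<delta>c
        by (simp_all add: \<sigma>_def a_def a'_def d_def d'_def Aut.m_assoc Aut_cancel)
      have "a = \<sigma> \<otimes>\<^bsub>A\<^esub> a' \<otimes>\<^bsub>A\<^esub> inv\<^bsub>A\<^esub> \<sigma>"
        unfolding conj(1) using \<sigma> ac by (simp add: Aut.m_assoc)
      then have ga: "g \<otimes>\<^bsub>A\<^esub> a = d \<otimes>\<^bsub>A\<^esub> \<sigma> \<otimes>\<^bsub>A\<^esub> b \<otimes>\<^bsub>A\<^esub> inv\<^bsub>A\<^esub> \<sigma>"
        unfolding conj(2)[symmetric] g b_def using \<sigma> ac jc by (simp add: Aut.m_assoc Aut_cancel)
      have ga_apply: "g (a z) = d (\<sigma> (b z))" if "z \<in> rball (r + k)" for z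
      proof -
        have zV: "z \<in> V"
          using that ball_subset by blast
        then have "(g \<otimes>\<^bsub>A\<^esub> a) z = d (\<sigma> (b ((inv\<^bsub>A\<^esub> \<sigma>) z)))"
          unfolding ga using \<sigma> ac bc by (simp add: mult_apply Aut_apply_in)
        then show ?thesis
          using that zV gc ac by (simp add: inv\<sigma>_fix mult_apply)
      qed
      have small: "x \<in> rball (r + k)" "y \<in> rball (r + k)"
        using \<gamma> \<delta> graph_ball_mono[of r "r + k" E v\<^sub>0] by auto
      have xV: "x \<in> V" and yV: "y \<in> V"
        using small ball_subset by blast+
      have "d (\<sigma> (b x)) = d y"
        using ga_apply[OF small(1)] \<gamma>(3) \<delta>(3) by (simp add: a_def d_def)
      then have "\<sigma> (b x) = y"
        using ac \<sigma> bc xV yV by (metis Aut_apply_in inv_apply_left)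
      then have bx: "b x = y"
        using inv\<sigma>_fix[OF small(2)] inv_apply_eq[OF \<sigma> Aut_apply_in[OF bc xV]] by simp
      \<comment> \<open>Since \<open>b\<close> sends \<open>x\<close> to \<open>y\<close> and both
        are within \<open>r\<close> of the root, \<open>b\<close> moves the root by at most
        \<open>2 * r\<close>. The extra \<open>k\<close> in the radius makes the agreement with
        \<open>h\<close> cover the \<open>k\<close>-ball around \<open>x\<close>.\<close>
      have "v\<^sub>0 \<in> graph_ball E x r"
        by (rule graph_ball_sym[OF sym_E \<gamma>(2)])
      then have "b v\<^sub>0 \<in> graph_ball E y r"
        using Aut_graph_ball[OF bc xV] bx by metis
      then have "b v\<^sub>0 \<in> rball (2 * r)"
        using graph_ball_trans[OF \<delta>(2)] by (simp add: mult_2)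
      then have "b v\<^sub>0 \<in> rball (2 * r + k)"
        using graph_ball_mono[of "2 * r" "2 * r + k" E v\<^sub>0] by auto
      then obtain h where h: "h \<in> H" "\<And>z. z \<in> rball (2 * r + k) \<Longrightarrow> b z = h z"
        using nbhd_approx[OF H J bJ] by blast
      have hc: "h \<in> carrier A"
        by (rule Sub_carrier[OF H h(1)])
      \<comment> \<open>Undoing the translations turns the approximation \<open>h\<close> of
        \<open>b\<close> near \<open>x\<close> into one of \<open>g\<close> near \<open>v\<close>.
        Here \<sigma> has no effect, because \<open>z\<close> and \<open>b z\<close> both stay in
        \<open>rball (r + k)\<close>.\<close>
      have "g w = (d \<otimes>\<^bsub>A\<^esub> h \<otimes>\<^bsub>A\<^esub> inv\<^bsub>A\<^esub> a) w" if w: "w \<in> graph_ball E v k" for w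
      proof -
        have wV: "w \<in> V"
          using w v graph_ball_subset by blast
        define z where "z = (inv\<^bsub>A\<^esub> a) w"
        have zV: "z \<in> V" and az: "a z = w"
          using ac wV by (auto simp: z_def Aut_apply_in inv_apply_right)
        have "(inv\<^bsub>A\<^esub> a) v = x"
          using inv_apply_eq[OF ac(1) xV] \<gamma>(3) by (simp add: a_def)
        then have zk: "z \<in> graph_ball E x k"
          using Aut_graph_ball[OF _ v w, of "inv\<^bsub>A\<^esub> a"] ac by (simp add: z_def)
        then have z: "z \<in> rball (r + k)"
          by (rule graph_ball_trans[OF \<gamma>(2)])
        have "b z \<in> graph_ball E y k"
          using Aut_graph_ball[OF bc xV zk] bx by simp
        then have "b z \<in> rball (r + k)"
          by (rule graph_ball_trans[OF \<delta>(2)])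
        then have "g w = d (b z)"
          using ga_apply[OF z] az \<sigma>_fix by simp
        also have "b z = h z"
          using h(2) z graph_ball_mono[of "r + k" "2 * r + k" E v\<^sub>0] by auto
        finally show ?thesis
          using ac hc wV by (simp add: z_def mult_apply Aut_apply_in)
      qed
      moreover have "d \<otimes>\<^bsub>A\<^esub> h \<otimes>\<^bsub>A\<^esub> inv\<^bsub>A\<^esub> a \<in> H"
        using H_mem h Sub_subgroup[OF H] by (simp add: subgroup.m_closed subgroup.m_inv_closed)
      ultimately show ?thesis
        by blast
    qed
    then show "g \<in> k_closure V E k H"
      using gc by (auto simp: k_closure_def)
  qed
  ultimately show ?thesis
    unfolding subconj_def by blast
qed

section \<open>Local uniformity in the conjugator, then compactness\<close>

lemma local_subconj:
  assumes \<Gamma>: "subgroup \<Gamma> A" and R: "\<And>x. x \<in> V \<Longrightarrow> \<exists>\<gamma>\<in>\<Gamma>. \<exists>y\<in>rball R. x = \<gamma> y"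
    and H: "H \<in> Sub" and \<tau>: "\<tau> \<in> carrier A"
  shows "\<exists>O' n. openin \<T> O' \<and> \<tau> \<in> O' \<and>
    (\<forall>\<tau>'\<in>O'. \<forall>J\<in>nbhd H n. contains_conj \<Gamma> \<tau>' J \<longrightarrow> subconj k H J)"
proof (cases "contains_conj \<Gamma> \<tau> H")
  case True
  obtain r where r: "\<tau> ` rball R \<subseteq> rball r"
    using finite_subset_ball[of "\<tau> ` rball R"] finite_graph_ball[OF root] ball_subset \<tau>
    by (force simp: Aut_apply_in)
  \<comment> \<open>Agreement with \<tau> on \<open>F\<close> says that
    \<open>\<tau>' \<otimes> inv \<tau>\<close> fixes \<open>rball (r + k)\<close>
    pointwise.\<close>
  define F where "F = (inv\<^bsub>A\<^esub> \<tau>) ` rball (r + k)"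
  have F: "finite F" "F \<subseteq> V"
    using finite_graph_ball[OF root] ball_subset \<tau> by (auto simp: F_def Aut_apply_in)
  define O' where "O' = {\<tau>' \<in> carrier A. \<forall>x\<in>F. \<tau>' x = \<tau> x}"
  have "subconj k H J"
    if "\<tau>' \<in> O'" "J \<in> nbhd H (2 * r + k)" "contains_conj \<Gamma> \<tau>' J" for \<tau>' J
  proof (rule subconj_if_contained[OF \<Gamma> R H \<tau> True r])
    show "\<tau>' ((inv\<^bsub>A\<^esub> \<tau>) x) = x" if "x \<in> rball (r + k)" for x
      using \<open>\<tau>' \<in> O'\<close> that inv_apply_right[OF \<tau> ball_subset] by (auto simp: O'_def F_def)
  qed (use that in \<open>auto simp: O'_def\<close>)
  moreover have "openin \<T> O'" "\<tau> \<in> O'"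
    unfolding O'_def using F \<tau> by (auto intro!: openin_agree simp: Aut_apply_in subset_iff)
  ultimately show ?thesis
    by blast
next
  case False
  then obtain \<gamma> where \<gamma>: "\<gamma> \<in> \<Gamma>" and notin: "\<tau> \<otimes>\<^bsub>A\<^esub> \<gamma> \<otimes>\<^bsub>A\<^esub> inv\<^bsub>A\<^esub> \<tau> \<notin> H"
    by (auto simp: contains_conj_def)
  define c where "c = \<tau> \<otimes>\<^bsub>A\<^esub> \<gamma> \<otimes>\<^bsub>A\<^esub> inv\<^bsub>A\<^esub> \<tau>"
  have \<gamma>c: "\<gamma> \<in> carrier A"
    using \<gamma> by (auto intro: subgroup.mem_carrier[OF \<Gamma>])
  then have cc: "c \<in> carrier A"
    using \<tau> by (simp add: c_def)
  \<comment> \<open>As \<open>H\<close> is closed, the failure of \<open>c\<close> to lie in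
    \<open>H\<close> is already visible on a finite set \<open>F\<close>.\<close>
  have "openin \<T> (carrier A - H)"
    using H by (auto simp: closed_subgroups_def closedin_def topspace_Aut)
  moreover have "c \<in> carrier A - H"
    using cc notin by (simp add: c_def)
  ultimately obtain F where F: "finite F" "F \<subseteq> V"
    and F_out: "\<And>g. g \<in> carrier A \<Longrightarrow> \<forall>x\<in>F. g x = c x \<Longrightarrow> g \<in> carrier A - H"
    by (rule openin_contains_agree) blast
  \<comment> \<open>Including \<open>c v\<^sub>0\<close> ensures that \<open>c'\<close>, which
    agrees with \<open>c\<close> at the root, is among the elements of \<open>J\<close> that
    closeness to \<open>H\<close> approximates.\<close>
  obtain n where n: "insert (c v\<^sub>0) F \<subseteq> rball n"
    using finite_subset_ball[of "insert (c v\<^sub>0) F"] F Aut_apply_in[OF cc root] by auto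
  \<comment> \<open>On \<open>v\<^sub>0\<close> and \<open>F\<close>, the value of \<open>c'\<close>
    depends on \<open>\<tau>'\<close> only through its values at the points of \<open>D\<close> and
    their \<gamma>-images.\<close>
  define D where "D = (inv\<^bsub>A\<^esub> \<tau>) ` insert v\<^sub>0 F"
  define O' where "O' = {\<tau>' \<in> carrier A. \<forall>x\<in>D \<union> \<gamma> ` D. \<tau>' x = \<tau> x}"
  have D: "finite D" "D \<subseteq> V"
    using F root \<tau> by (auto simp: D_def Aut_apply_in subset_iff)
  have "False"
    if \<tau>'O: "\<tau>' \<in> O'" and J: "J \<in> nbhd H n" and cont: "contains_conj \<Gamma> \<tau>' J" for \<tau>' J
  proof -
    have \<tau>': "\<tau>' \<in> carrier A"
      using \<tau>'O by (simp add: O'_def)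
    define c' where "c' = \<tau>' \<otimes>\<^bsub>A\<^esub> \<gamma> \<otimes>\<^bsub>A\<^esub> inv\<^bsub>A\<^esub> \<tau>'"
    have "c' \<in> J"
      using cont \<gamma> by (simp add: contains_conj_def c'_def)
    have eq: "c' x = c x" if x: "x \<in> insert v\<^sub>0 F" for x
    proof -
      have xV: "x \<in> V"
        using x F root by blast
      have xD: "(inv\<^bsub>A\<^esub> \<tau>) x \<in> D"
        unfolding D_def using x by (rule imageI)
      then have "\<tau>' ((inv\<^bsub>A\<^esub> \<tau>) x) = x"
        using \<tau>'O inv_apply_right[OF \<tau> xV] by (auto simp: O'_def)
      then have "(inv\<^bsub>A\<^esub> \<tau>') x = (inv\<^bsub>A\<^esub> \<tau>) x"
        using \<tau>' D xD by (intro inv_apply_eq) auto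
      then have "c' x = \<tau>' (\<gamma> ((inv\<^bsub>A\<^esub> \<tau>) x))"
        using \<tau>' \<gamma>c xV by (simp add: c'_def conj_apply)
      also have "\<dots> = \<tau> (\<gamma> ((inv\<^bsub>A\<^esub> \<tau>) x))"
        using \<tau>'O xD by (auto simp: O'_def)
      also have "\<dots> = c x"
        using \<tau> \<gamma>c xV by (simp add: c_def conj_apply)
      finally show ?thesis .
    qed
    then have "c' v\<^sub>0 \<in> rball n"
      using n by simp
    then obtain h where h: "h \<in> H" "\<And>x. x \<in> rball n \<Longrightarrow> c' x = h x"
      using nbhd_approx[OF H J \<open>c' \<in> J\<close>] by blast
    \<comment> \<open>The approximation \<open>h\<close> to \<open>c'\<close> lies in
      \<open>H\<close> but agrees with \<open>c\<close> on \<open>F\<close>, which excludes it from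
      \<open>H\<close>.\<close>
    have "\<forall>x\<in>F. h x = c x"
      using h n eq by (metis insert_iff subset_iff)
    then show False
      using F_out[OF Sub_carrier[OF H h(1)]] h(1) by auto
  qed
  moreover have "openin \<T> O'" "\<tau> \<in> O'"
    unfolding O'_def using D \<tau> \<gamma>c
    by (auto intro!: openin_agree simp: Aut_apply_in subset_iff)
  ultimately show ?thesis
    by blast
qed

text \<open>Conjugators may be taken in the compact set \<open>moving R\<close>, with
  \<open>R\<close> independent of \<open>J\<close>. Finitely many local neighborhoods cover it, and
  the largest of their radii works for all \<open>J\<close>.\<close>

lemma uniform_subconj:
  assumes \<Gamma>: "subgroup \<Gamma> A" and cocompact: "acts_cocompactly V E \<Gamma>" and H: "H \<in> Sub"
  obtains n where
    "\<And>J. J \<in> nbhd H n \<Longrightarrow> J \<in> closed_subgroups_above A \<T> \<Gamma> \<Longrightarrow> subconj k H J"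
proof -
  obtain R where R: "\<And>x. x \<in> V \<Longrightarrow> \<exists>\<gamma>\<in>\<Gamma>. \<exists>y\<in>rball R. x = \<gamma> y"
    using cocompact_imp_ball[OF \<Gamma> cocompact] by blast
  define good where "good O' n \<longleftrightarrow> openin \<T> O' \<and>
    (\<forall>\<tau>'\<in>O'. \<forall>J\<in>nbhd H n. contains_conj \<Gamma> \<tau>' J \<longrightarrow> subconj k H J)" for O' n
  have "moving R \<subseteq> \<Union>{O'. \<exists>n. good O' n}"
  proof
    fix \<tau> assume "\<tau> \<in> moving R"
    then show "\<tau> \<in> \<Union>{O'. \<exists>n. good O' n}"
      using local_subconj[OF \<Gamma> R H, of \<tau> k] unfolding good_def moving_def by blast
  qed
  then obtain \<F> where \<F>: "finite \<F>" "\<F> \<subseteq> {O'. \<exists>n. good O' n}" "moving R \<subseteq> \<Union>\<F>"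
    using compactinD[OF compactin_moving[of R], of "{O'. \<exists>n. good O' n}"]
    unfolding good_def by blast
  then have "\<forall>O'\<in>\<F>. \<exists>n. good O' n"
    by blast
  then obtain N where N: "\<And>O'. O' \<in> \<F> \<Longrightarrow> good O' (N O')"
    by metis
  \<comment> \<open>The \<open>0\<close> keeps \<open>Max\<close> defined when the cover is
    empty.\<close>
  define n where "n = Max (insert 0 (N ` \<F>))"
  have "subconj k H J" if J: "J \<in> nbhd H n" "J \<in> closed_subgroups_above A \<T> \<Gamma>" for J
  proof -
    obtain \<tau>' where "\<tau>' \<in> carrier A" "contains_conj \<Gamma> \<tau>' J"
      using J(2) by (auto simp: closed_subgroups_above_iff)
    then obtain \<tau> where \<tau>: "\<tau> \<in> moving R" "contains_conj \<Gamma> \<tau> J"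
      using contains_conj_bounded[OF \<Gamma>] R by metis
    then obtain O' where O': "O' \<in> \<F>" "\<tau> \<in> O'"
      using \<F>(3) by blast
    have "N O' \<le> n"
      using O'(1) \<F>(1) by (simp add: n_def)
    then have "J \<in> nbhd H (N O')"
      using J(1) nbhd_antimono by blast
    then show ?thesis
      using N[OF O'(1)] O'(2) \<tau>(2) unfolding good_def by blast
  qed
  then show ?thesis
    using that by blast
qed

end

theorem proposition3p2:
  fixes V :: "'v set" and E :: "'v rel" and \<Gamma> H :: "('v \<Rightarrow> 'v) set"
    and v\<^sub>0 :: 'v and k :: nat
  assumes "simple_graph V E"
    and "graph_connected V E"
    and "graph_locally_finite V E"
    and "subgroup \<Gamma> (Aut V E)"
    and "acts_cocompactly V E \<Gamma>"
    and "H \<in> closed_subgroups_above (Aut V E) (Aut_topology V E) \<Gamma>"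
    and "v\<^sub>0 \<in> V"
  shows "neighborhood_in
    (subtopology (chabauty_topology (Aut V E) (Aut_topology V E))
      (closed_subgroups_above (Aut V E) (Aut_topology V E) \<Gamma>))
    H
    {J \<in> closed_subgroups_above (Aut V E) (Aut_topology V E) \<Gamma>.
      \<exists>\<sigma>\<in>ball_fixator E (carrier (Aut V E)) v\<^sub>0 k.
        \<sigma> <#\<^bsub>Aut V E\<^esub> J #>\<^bsub>Aut V E\<^esub> inv\<^bsub>Aut V E\<^esub> \<sigma> \<subseteq> k_closure V E k H}"
    (is "neighborhood_in (subtopology ?C ?X) H ?N")
proof -
  interpret rooted_graph V E v\<^sub>0
    using assms by unfold_locales
  have H: "H \<in> Sub"
    using assms(6) by (simp add: closed_subgroups_above_def)
  have N: "?N = {J \<in> ?X. subconj k H J}"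
    by (simp add: subconj_def fixing_def)
  obtain n where n: "\<And>J. J \<in> nbhd H n \<Longrightarrow> J \<in> ?X \<Longrightarrow> subconj k H J"
    using uniform_subconj[OF assms(4,5) H] by blast
  have "topspace ?C = Sub"
    by (simp add: topspace_chabauty_topology topspace_Aut)
  then have "?N \<subseteq> topspace (subtopology ?C ?X)"
    by (auto simp: closed_subgroups_above_def)
  \<comment> \<open>The trace of \<open>nbhd H n\<close> is itself open in the subspace, so it
    serves directly as the open set inside the neighborhood.\<close>
  moreover have "openin (subtopology ?C ?X) (?X \<inter> nbhd H n)"
    by (rule openin_subtopology_Int2[OF openin_nbhd[OF H]])
  moreover have "H \<in> ?X \<inter> nbhd H n"
    using assms(6) nbhd_refl[OF H] by blast
  moreover have "?X \<inter> nbhd H n \<subseteq> ?N"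
    unfolding N using n by blast
  ultimately show ?thesis
    unfolding neighborhood_in_def by blast
qed

end
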